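(* If the non-autonomous system $(X,f_{1,\infty})$ has the strong specification property (SSP), then $(\mathcal{M}(X),\widetilde{f}_{1,\infty})$ also has SSP.
   Context: A non-autonomous (discrete) system $(X,f_{1,\infty})$ consists of a compact metric space $(X,d)$ and a sequence $f_{1,\infty}=(f_n)_{n\ge 1}$ of continuous surjective maps $f_n:X\to X$. Write $\mathbb{N}=\{1,2,\dots\}$, $f_1^0=\mathrm{id}$ and $f_1^n=f_n\circ\cdots\circ f_1$ for $n\ge1$. $\mathcal{M}(X)$ is the set of Borel probability measures on $(X,\mathcal{B}(X))$, where $\mathcal{B}(X)$ is the Borel $\sigma$-algebra, equipped with the Prohorov metric $\mathcal{D}(\mu,\nu)=\inf\{\epsilon>0:\mu(A)\le\nu(N(A,\epsilon))+\epsilon \text{ and } \nu(A)\le\mu(N(A,\epsilon))+\epsilon \text{ for each } A\in\mathcal{B}(X)\}$, where $N(A,\epsilon)=\bigcup_{a\in A}B_d(a,\epsilon)$ and $B_d(a,\epsilon)$ is the open ball (this metric induces the weak*-topology). The induced system is $\widetilde{f}_{1,\infty}=(\widetilde{f}_n)_{n\ge1}$ with $\widetilde{f}_n(\mu)(A)=\mu(f_n^{-1}(A))$, so that $\widetilde{f}_1^n(\mu)(A)=\mu((f_1^n)^{-1}(A))$. A point $z$ is periodic with period $p\in\mathbb{N}$ if $f_1^{pm}(z)=z$ for every $m\in\mathbb{N}$ ($p$ need not be minimal). $(X,f_{1,\infty})$ has the strong specification property (SSP) if for every $\epsilon>0$ there is a positive integer $M(\epsilon)$ such that for every $s\in\mathbb{N}$,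 every choice of points $x_1,\dots,x_s\in X$, every sequence $a_1\le b_1<a_2\le b_2<\cdots<a_s\le b_s$ of non-negative integers with $a_j-b_{j-1}>M(\epsilon)$ for $2\le j\le s$, and every integer $p>M(\epsilon)+b_s-a_1$, there is a periodic point $z\in X$ with period $p$ such that $d(f_1^j(z),f_1^j(x_i))<\epsilon$ for all $a_i\le j\le b_i$, $1\le i\le s$. For $(\mathcal{M}(X),\widetilde{f}_{1,\infty})$ the same definition is used with the metric $\mathcal{D}$. *)

theory Defs
  imports "HOL-Probability.Probability"
begin

text \<open>
  A space is given by its carrier \<^term>\<open>X\<close>, a subset of a type of class
  \<^class>\<open>metric_space\<close>. A sequence of maps is indexed by the positive integers,
  so its value at \<open>0\<close> is never used.
\<close>

definition nonautonomous_system :: "'a::metric_space set \<Rightarrow> (nat \<Rightarrow> 'a \<Rightarrow> 'a) \<Rightarrow> bool" where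
  "nonautonomous_system X f \<longleftrightarrow>
     compact X \<and> (\<forall>n\<ge>1. continuous_on X (f n) \<and> f n ` X = X)"

primrec iter :: "(nat \<Rightarrow> 'a \<Rightarrow> 'a) \<Rightarrow> nat \<Rightarrow> 'a \<Rightarrow> 'a" where
  "iter f 0 = id"
| "iter f (Suc n) = f (Suc n) \<circ> iter f n"

definition periodic_point :: "(nat \<Rightarrow> 'a \<Rightarrow> 'a) \<Rightarrow> nat \<Rightarrow> 'a \<Rightarrow> bool" where
  "periodic_point f p z \<longleftrightarrow> p \<ge> 1 \<and> (\<forall>m\<ge>1. iter f (p * m) z = z)"

text \<open>
  The carrier and the metric are explicit arguments, because the property is used both for the
  underlying space and for its space of probability measures. No truncation occurs in
  \<open>M + b s - a 1\<close>, since the conditions on \<open>a\<close> and \<open>b\<close> imply \<open>a 1 \<le> b s\<close>.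
\<close>

definition strong_specification ::
    "'a set \<Rightarrow> ('a \<Rightarrow> 'a \<Rightarrow> real) \<Rightarrow> (nat \<Rightarrow> 'a \<Rightarrow> 'a) \<Rightarrow> bool" where
  "strong_specification X d f \<longleftrightarrow>
     (\<forall>\<epsilon>>0. \<exists>M::nat. M \<ge> 1 \<and>
        (\<forall>(s::nat) (x::nat \<Rightarrow> 'a) (a::nat \<Rightarrow> nat) (b::nat \<Rightarrow> nat) (p::nat).
           s \<ge> 1 \<longrightarrow>
           (\<forall>i\<in>{1..s}. x i \<in> X) \<longrightarrow>
           (\<forall>i\<in>{1..s}. a i \<le> b i) \<longrightarrow>
           (\<forall>j\<in>{2..s}. b (j - 1) < a j \<and> a j - b (j - 1) > M) \<longrightarrow>
           p > M + b s - a 1 \<longrightarrow>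
           (\<exists>z\<in>X. periodic_point f p z \<and>
              (\<forall>i\<in>{1..s}. \<forall>j\<in>{a i..b i}. d (iter f j z) (iter f j (x i)) < \<epsilon>))))"

definition prob_measures :: "'a::metric_space set \<Rightarrow> 'a measure set" where
  "prob_measures X = {\<mu>. prob_space \<mu> \<and> sets \<mu> = sets (restrict_space borel X)}"

definition neighbourhood :: "'a::metric_space set \<Rightarrow> 'a set \<Rightarrow> real \<Rightarrow> 'a set" where
  "neighbourhood X A \<epsilon> = (\<Union>a\<in>A. ball a \<epsilon> \<inter> X)"

definition prohorov :: "'a::metric_space set \<Rightarrow> 'a measure \<Rightarrow> 'a measure \<Rightarrow> real" where
  "prohorov X \<mu> \<nu> = Inf {\<epsilon>. \<epsilon> > 0 \<and>
     (\<forall>A\<in>sets (restrict_space borel X).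
        measure \<mu> A \<le> measure \<nu> (neighbourhood X A \<epsilon>) + \<epsilon> \<and>
        measure \<nu> A \<le> measure \<mu> (neighbourhood X A \<epsilon>) + \<epsilon>)}"

definition induced :: "'a::metric_space set \<Rightarrow> (nat \<Rightarrow> 'a \<Rightarrow> 'a) \<Rightarrow> nat \<Rightarrow> 'a measure \<Rightarrow> 'a measure" where
  "induced X f n \<mu> = distr \<mu> (restrict_space borel X) (f n)"

end

theory Submission
  imports Defs
begin

text \<open>
  Couple the given measures \<open>\<mu>\<^sub>1, \<dots>, \<mu>\<^sub>s\<close> by their product \<open>P\<close> on tuples of points of \<open>X\<close>. By
  compactness every point can be moved, through a measurable map with finitely many values, to a
  point whose orbit stays close to the original one up to any given time. Applying specification
  in \<open>X\<close> to the finitely many tuples that arise gives a measurable map \<open>Z\<close> from tuples to periodic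
  points of period \<open>p\<close>, such that the orbit of \<open>Z \<omega>\<close> follows that of \<open>\<omega>\<^sub>i\<close> on the \<open>i\<close>-th time
  interval. The image of \<open>P\<close> under \<open>Z\<close> is the required measure: it is periodic because \<open>Z\<close> takes
  periodic values, and it is close to \<open>\<mu>\<^sub>i\<close> along the orbit because \<open>\<mu>\<^sub>i\<close> is the image of \<open>P\<close> under
  the \<open>i\<close>-th projection, and uniformly close maps have Prohorov-close distributions.
\<close>

lemma neighbourhood_measurable:
  "neighbourhood X A \<delta> \<in> sets (restrict_space borel X)"
proof -
  have "neighbourhood X A \<delta> = X \<inter> (\<Union>a\<in>A. ball a \<delta>)"
    by (auto simp: neighbourhood_def)
  moreover have "(\<Union>a\<in>A. ball a \<delta>) \<in> sets borel"
    by (intro borel_open) auto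
  ultimately show ?thesis
    by (auto simp: sets_restrict_space)
qed

text \<open>\<open>P\<close> couples the two distributions. Wherever \<open>U\<close> lands in
  \<open>A\<close>, \<open>V\<close> lands in the \<open>\<delta>\<close>-neighbourhood of
  \<open>A\<close>, so an inclusion of preimages in \<open>P\<close> gives the inequality of
  measures, and \<open>\<delta>\<close> is admissible in the infimum.\<close>

lemma prohorov_distr_le:
  fixes X :: "'a::metric_space set"
  assumes "finite_measure P"
    and U: "U \<in> P \<rightarrow>\<^sub>M restrict_space borel X"
    and V: "V \<in> P \<rightarrow>\<^sub>M restrict_space borel X"
    and "\<delta> > 0"
    and close: "\<And>\<omega>. \<omega> \<in> space P \<Longrightarrow> dist (U \<omega>) (V \<omega>) < \<delta>"
  shows "prohorov X (distr P (restrict_space borel X) U) (distr P (restrict_space borel X) V) \<le> \<delta>"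
proof -
  interpret finite_measure P by fact
  \<comment> \<open>Stated for arbitrary \<open>U'\<close> and \<open>V'\<close>, since swapping the
    two maps yields the other Prohorov inequality by symmetry of \<open>dist\<close>.\<close>
  have half: "measure (distr P (restrict_space borel X) U') A
      \<le> measure (distr P (restrict_space borel X) V') (neighbourhood X A \<delta>) + \<delta>"
    if U': "U' \<in> P \<rightarrow>\<^sub>M restrict_space borel X" and V': "V' \<in> P \<rightarrow>\<^sub>M restrict_space borel X"
      and d: "\<And>\<omega>. \<omega> \<in> space P \<Longrightarrow> dist (U' \<omega>) (V' \<omega>) < \<delta>"
      and A: "A \<in> sets (restrict_space borel X)" for U' V' A
  proof -
    have "U' -` A \<inter> space P \<subseteq> V' -` neighbourhood X A \<delta> \<inter> space P"
      using d measurable_space[OF V'] by (fastforce simp: neighbourhood_def space_restrict_space)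
    then have "measure P (U' -` A \<inter> space P) \<le> measure P (V' -` neighbourhood X A \<delta> \<inter> space P)"
      by (intro finite_measure_mono measurable_sets[OF V'] neighbourhood_measurable)
    then show ?thesis
      using \<open>\<delta> > 0\<close> by (simp add: measure_distr U' V' A neighbourhood_measurable)
  qed
  show ?thesis
    unfolding prohorov_def
    by (rule cInf_lower) (use \<open>\<delta> > 0\<close> in \<open>auto intro!: half U V close bdd_belowI[of _ 0]
        simp: dist_commute close\<close>)
qed

lemma iter_mem:
  assumes "nonautonomous_system X f" "x \<in> X"
  shows "iter f n x \<in> X"
  using assms by (induction n) (auto simp: nonautonomous_system_def)

lemma continuous_on_iter:
  assumes "nonautonomous_system X f"
  shows "continuous_on X (iter f n)"
proof (induction n)
  case 0
  show ?case by (simp add: id_def)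
next
  case (Suc n)
  have "continuous_on (iter f n ` X) (f (Suc n))"
    by (rule continuous_on_subset[where s = X])
      (use assms iter_mem[OF assms] in \<open>auto simp: nonautonomous_system_def\<close>)
  then show ?case
    unfolding iter.simps by (rule continuous_on_compose[OF Suc])
qed

lemma measurable_iter:
  assumes "nonautonomous_system X f"
  shows "iter f n \<in> restrict_space borel X \<rightarrow>\<^sub>M restrict_space borel X"
  using assms
  by (intro measurable_restrict_space2 borel_measurable_continuous_on_restrict
      continuous_on_iter) (auto simp: space_restrict_space iter_mem)

text \<open>This keeps the whole orbit of a measure on one probability space \<open>P\<close>:
  measures along the orbit are compared by comparing points of \<open>X\<close> for each
  outcome.\<close>

lemma iter_induced_distr:
  assumes sys: "nonautonomous_system X f" and U: "U \<in> P \<rightarrow>\<^sub>M restrict_space borel X"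
  shows "iter (induced X f) n (distr P (restrict_space borel X) U)
    = distr P (restrict_space borel X) (\<lambda>\<omega>. iter f n (U \<omega>))"
proof (induction n)
  case 0
  show ?case by simp
next
  case (Suc n)
  have f: "f (Suc n) \<in> restrict_space borel X \<rightarrow>\<^sub>M restrict_space borel X"
    using sys by (intro measurable_restrict_space2 borel_measurable_continuous_on_restrict)
      (auto simp: nonautonomous_system_def space_restrict_space)
  show ?case
    using measurable_compose[OF U measurable_iter[OF sys]]
    by (simp add: Suc induced_def[of X f "Suc n"] distr_distr[OF f] comp_def)
qed

text \<open>Rounding to finitely many values is what later makes an arbitrary choice of shadowing
  points measurable.\<close>

lemma finite_orbit_approximation:
  fixes X :: "'a::metric_space set"
  assumes sys: "nonautonomous_system X f" and "\<delta> > 0"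
  obtains F c where "finite F" "F \<subseteq> X" "c \<in> restrict_space borel X \<rightarrow>\<^sub>M count_space F"
    "\<And>x j. x \<in> X \<Longrightarrow> j \<le> N \<Longrightarrow> dist (iter f j (c x)) (iter f j x) < \<delta>"
proof -
  \<comment> \<open>\<open>U y\<close> is an open ball for the metric that takes the maximal
    distance of the orbits up to time \<open>N\<close>. It is open in \<open>X\<close> because
    finitely many continuous iterates are involved.\<close>
  define U where "U y = {x\<in>X. \<forall>j\<in>{..N}. dist (iter f j y) (iter f j x) < \<delta>}" for y
  have U_open: "openin (top_of_set X) (U y)" for y
  proof -
    have "openin (top_of_set X) (X \<inter> iter f j -` ball (iter f j y) \<delta>)" for j
      by (intro continuous_openin_preimage_gen continuous_on_iter sys) auto
    then have "openin (top_of_set X) (\<Inter>j\<in>{..N}. X \<inter> iter f j -` ball (iter f j y) \<delta>)"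
      by (intro openin_INT2) auto
    also have "(\<Inter>j\<in>{..N}. X \<inter> iter f j -` ball (iter f j y) \<delta>) = U y"
      by (auto simp: U_def)
    finally show ?thesis .
  qed
  have U_sets: "U y \<in> sets (restrict_space borel X)" for y
  proof -
    obtain T where "open T" "U y = X \<inter> T"
      using U_open[of y] unfolding openin_open by blast
    then show ?thesis by (auto simp: sets_restrict_space)
  qed
  have "compact X" using sys by (simp add: nonautonomous_system_def)
  moreover have "X \<subseteq> (\<Union>y\<in>X. U y)"
    using \<open>\<delta> > 0\<close> by (auto simp: U_def)
  ultimately obtain D where "D \<subseteq> U ` X" "finite D" "X \<subseteq> \<Union>D"
    using U_open unfolding compact_eq_openin_cover by (metis (no_types, lifting) imageE)
  then obtain F where F: "F \<subseteq> X" "finite F" "X \<subseteq> (\<Union>y\<in>F. U y)"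
    using finite_subset_image[of D U X] by blast
  obtain ys where ys: "set ys = F"
    using finite_list[OF F(2)] by blast
  \<comment> \<open>The sets of the cover may overlap. Taking the first one that contains
    \<open>x\<close> is a measurable choice.\<close>
  define L where "L x = (LEAST i. i < length ys \<and> x \<in> U (ys ! i))" for x
  define c where "c x = ys ! L x" for x
  have L: "L x < length ys \<and> x \<in> U (ys ! L x)" if "x \<in> X" for x
  proof -
    have "\<exists>i. i < length ys \<and> x \<in> U (ys ! i)"
      using F(3) ys \<open>x \<in> X\<close> by (metis UN_E in_mono in_set_conv_nth)
    then show ?thesis
      unfolding L_def by (rule LeastI_ex)
  qed
  have [measurable]: "Measurable.pred (restrict_space borel X) (\<lambda>x. x \<in> U y)" for y
    using U_sets by (intro pred_sets2[where N = "restrict_space borel X"]) auto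
  have "L \<in> restrict_space borel X \<rightarrow>\<^sub>M count_space UNIV"
    unfolding L_def by measurable
  then have "c \<in> restrict_space borel X \<rightarrow>\<^sub>M count_space UNIV"
    unfolding c_def by (rule measurable_compose) simp
  moreover have "c x \<in> F" if "x \<in> X" for x
    using L[OF that] ys by (auto simp: c_def)
  ultimately have "c \<in> restrict_space borel X \<rightarrow>\<^sub>M count_space F"
    using F(2) measurable_sets[of c "restrict_space borel X" "count_space UNIV"]
    by (auto simp: measurable_count_space_eq2 space_restrict_space)
  moreover have "dist (iter f j (c x)) (iter f j x) < \<delta>" if "x \<in> X" "j \<le> N" for x j
    using L[OF that(1)] that(2) by (auto simp: c_def U_def)
  ultimately show thesis
    using that F by blast
qed

text \<open>The spacing of the time intervals enters only through \<open>shadow\<close>, that is,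
  through shadowing of tuples of points. The bound \<open>2 * \<delta>\<close> allows one
  \<open>\<delta>\<close> for rounding the tuple and one for shadowing the rounded tuple.\<close>

lemma induced_specification_witness:
  fixes X :: "'a::metric_space set" and \<mu> :: "nat \<Rightarrow> 'a measure"
  assumes sys: "nonautonomous_system X f" and "\<delta> > 0" and "finite I"
    and \<mu>: "\<And>i. i \<in> I \<Longrightarrow> \<mu> i \<in> prob_measures X"
    and shadow: "\<And>x. (\<And>i. i \<in> I \<Longrightarrow> x i \<in> X) \<Longrightarrow> \<exists>z\<in>X. periodic_point f p z \<and>
      (\<forall>i\<in>I. \<forall>j\<in>{a i..b i}. dist (iter f j z) (iter f j (x i)) < \<delta>)"
  shows "\<exists>\<nu>\<in>prob_measures X. periodic_point (induced X f) p \<nu> \<and>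
    (\<forall>i\<in>I. \<forall>j\<in>{a i..b i}.
      prohorov X (iter (induced X f) j \<nu>) (iter (induced X f) j (\<mu> i)) \<le> 2 * \<delta>)"
proof -
  let ?R = "restrict_space borel X"
  have \<mu>_prob: "prob_space (\<mu> i)" and \<mu>_sets: "sets (\<mu> i) = sets ?R" if "i \<in> I" for i
    using \<mu>[OF that] by (auto simp: prob_measures_def)
  define P where "P = PiM I \<mu>"
  interpret P: prob_space P
    unfolding P_def by (rule prob_space_PiM) (rule \<mu>_prob)
  have proj: "(\<lambda>\<omega>. \<omega> i) \<in> P \<rightarrow>\<^sub>M ?R" if "i \<in> I" for i
    using measurable_component_singleton[OF that, of \<mu>]
    by (simp add: P_def \<mu>_sets[OF that] cong: measurable_cong_sets)
  have \<mu>_eq: "\<mu> i = distr P ?R (\<lambda>\<omega>. \<omega> i)" if "i \<in> I" for i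
  proof -
    have "\<mu> i = distr P (\<mu> i) (\<lambda>\<omega>. \<omega> i)"
      unfolding P_def by (rule distr_PiM_component[symmetric]) (use \<mu>_prob that in auto)
    also have "\<dots> = distr P ?R (\<lambda>\<omega>. \<omega> i)"
      by (intro distr_cong refl \<mu>_sets that)
    finally show ?thesis .
  qed
  \<comment> \<open>The horizon \<open>sum b I\<close> dominates every \<open>b i\<close>, hence all
    times in all the intervals.\<close>
  obtain F c where F: "finite F" "F \<subseteq> X" and c: "c \<in> ?R \<rightarrow>\<^sub>M count_space F"
    and c_close: "\<And>x j. x \<in> X \<Longrightarrow> j \<le> sum b I \<Longrightarrow> dist (iter f j (c x)) (iter f j x) < \<delta>"
    using finite_orbit_approximation[OF sys \<open>\<delta> > 0\<close>, of "sum b I"] by blast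
  \<comment> \<open>The function \<open>z\<close> is chosen tuple by tuple, with no control over its
    measurability.\<close>
  have "\<forall>x. \<exists>w. (\<forall>i\<in>I. x i \<in> X) \<longrightarrow> w \<in> X \<and> periodic_point f p w \<and>
      (\<forall>i\<in>I. \<forall>j\<in>{a i..b i}. dist (iter f j w) (iter f j (x i)) < \<delta>)"
    using shadow by blast
  then obtain z where "\<forall>x. (\<forall>i\<in>I. x i \<in> X) \<longrightarrow> z x \<in> X \<and> periodic_point f p (z x) \<and>
      (\<forall>i\<in>I. \<forall>j\<in>{a i..b i}. dist (iter f j (z x)) (iter f j (x i)) < \<delta>)"
    by metis
  then have z: "z x \<in> X" "periodic_point f p (z x)"
      "\<And>i j. i \<in> I \<Longrightarrow> j \<in> {a i..b i} \<Longrightarrow> dist (iter f j (z x)) (iter f j (x i)) < \<delta>"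
    if "\<And>i. i \<in> I \<Longrightarrow> x i \<in> X" for x
    using that by blast+
  \<comment> \<open>Restricting to \<open>I\<close> puts the rounded tuple into the finite set
    \<open>I \<rightarrow>\<^sub>E F\<close>.\<close>
  define C where "C \<omega> = (\<lambda>i\<in>I. c (\<omega> i))" for \<omega>
  define Z where "Z \<omega> = z (C \<omega>)" for \<omega>
  have "C \<in> P \<rightarrow>\<^sub>M PiM I (\<lambda>_. count_space F)"
    unfolding C_def by (intro measurable_restrict measurable_compose[OF proj c])
  then have C: "C \<in> P \<rightarrow>\<^sub>M count_space (I \<rightarrow>\<^sub>E F)"
    using F \<open>finite I\<close> by (simp add: count_space_PiM_finite countable_finite)
  have C_mem: "C \<omega> i \<in> X" if "\<omega> \<in> space P" "i \<in> I" for \<omega> i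
    using measurable_space[OF C that(1)] that(2) F(2) by auto
  \<comment> \<open>On a discrete space every map into \<open>X\<close> is measurable, so composing
    with \<open>C\<close> repairs the arbitrary choice of \<open>z\<close>.\<close>
  have "z \<in> count_space (I \<rightarrow>\<^sub>E F) \<rightarrow>\<^sub>M ?R"
    using F(2) by (auto simp: space_restrict_space intro!: z(1))
  then have Z: "Z \<in> P \<rightarrow>\<^sub>M ?R"
    unfolding Z_def by (rule measurable_compose[OF C])
  define \<nu> where "\<nu> = distr P ?R Z"
  have "\<nu> \<in> prob_measures X"
    using P.prob_space_distr[OF Z] by (simp add: prob_measures_def \<nu>_def)
  moreover have "periodic_point (induced X f) p \<nu>"
  proof -
    have "periodic_point f p (Z \<omega>)" if "\<omega> \<in> space P" for \<omega>
      unfolding Z_def using C_mem[OF that] by (rule z(2))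
    \<comment> \<open>A probability space has an outcome \<open>\<omega>\<close>, and
      \<open>Z \<omega>\<close> has period \<open>p\<close>.\<close>
    moreover have "p \<ge> 1"
    proof -
      obtain \<omega> where "\<omega> \<in> space P" using P.not_empty by blast
      with calculation show ?thesis by (auto simp: periodic_point_def)
    qed
    ultimately show ?thesis
      by (auto simp: periodic_point_def \<nu>_def iter_induced_distr[OF sys Z] cong: distr_cong)
  qed
  moreover have "prohorov X (iter (induced X f) j \<nu>) (iter (induced X f) j (\<mu> i)) \<le> 2 * \<delta>"
    if i: "i \<in> I" and j: "j \<in> {a i..b i}" for i j
  proof -
    have "j \<le> sum b I"
      using j member_le_sum[OF i, of b] \<open>finite I\<close> by auto
    have "dist (iter f j (Z \<omega>)) (iter f j (\<omega> i)) < 2 * \<delta>" if \<omega>: "\<omega> \<in> space P" for \<omega>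
    proof -
      have "\<omega> i \<in> X"
        using measurable_space[OF proj[OF i] \<omega>] by (simp add: space_restrict_space)
      from c_close[OF this \<open>j \<le> sum b I\<close>]
      have "dist (iter f j (C \<omega> i)) (iter f j (\<omega> i)) < \<delta>"
        using i by (simp add: C_def)
      moreover have "dist (iter f j (Z \<omega>)) (iter f j (C \<omega> i)) < \<delta>"
        unfolding Z_def using C_mem[OF \<omega>] i j by (rule z(3))
      ultimately show ?thesis
        using dist_triangle[of "iter f j (Z \<omega>)" "iter f j (\<omega> i)" "iter f j (C \<omega> i)"] by linarith
    qed
    then show ?thesis
      unfolding \<mu>_eq[OF i] \<nu>_def iter_induced_distr[OF sys Z] iter_induced_distr[OF sys proj[OF i]]
      using \<open>\<delta> > 0\<close>
      by (intro prohorov_distr_le P.finite_measure_axioms measurable_compose[OF Z]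
          measurable_compose[OF proj[OF i]] measurable_iter[OF sys]) auto
  qed
  ultimately show ?thesis by blast
qed

theorem theorem5p3:
  fixes X :: "'a::metric_space set" and f :: "nat \<Rightarrow> 'a \<Rightarrow> 'a"
  assumes "nonautonomous_system X f"
    and "strong_specification X dist f"
  shows "strong_specification (prob_measures X) (prohorov X) (induced X f)"
  unfolding strong_specification_def
proof (intro allI impI)
  fix \<epsilon> :: real
  assume "\<epsilon> > 0"
  \<comment> \<open>The two errors add up to \<open>\<epsilon> / 2\<close>, which leaves room to
    turn the non-strict Prohorov bound into a strict one.\<close>
  then have "\<epsilon> / 4 > 0" by simp
  with assms(2)[unfolded strong_specification_def]
  obtain M :: nat where "M \<ge> 1" and M: "\<forall>(s::nat) x a b p. s \<ge> 1 \<longrightarrow>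
      (\<forall>i\<in>{1..s}. x i \<in> X) \<longrightarrow> (\<forall>i\<in>{1..s}. a i \<le> b i) \<longrightarrow>
      (\<forall>j\<in>{2..s}. b (j - 1) < a j \<and> a j - b (j - 1) > M) \<longrightarrow> p > M + b s - a 1 \<longrightarrow>
      (\<exists>z\<in>X. periodic_point f p z \<and>
        (\<forall>i\<in>{1..s}. \<forall>j\<in>{a i..b i}. dist (iter f j z) (iter f j (x i)) < \<epsilon> / 4))"
    by blast
  show "\<exists>M::nat. M \<ge> 1 \<and>
        (\<forall>(s::nat) (x::nat \<Rightarrow> 'a measure) (a::nat \<Rightarrow> nat) (b::nat \<Rightarrow> nat) (p::nat).
           s \<ge> 1 \<longrightarrow>
           (\<forall>i\<in>{1..s}. x i \<in> prob_measures X) \<longrightarrow>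
           (\<forall>i\<in>{1..s}. a i \<le> b i) \<longrightarrow>
           (\<forall>j\<in>{2..s}. b (j - 1) < a j \<and> a j - b (j - 1) > M) \<longrightarrow>
           p > M + b s - a 1 \<longrightarrow>
           (\<exists>z\<in>prob_measures X. periodic_point (induced X f) p z \<and>
              (\<forall>i\<in>{1..s}. \<forall>j\<in>{a i..b i}.
                prohorov X (iter (induced X f) j z) (iter (induced X f) j (x i)) < \<epsilon>)))"
  \<comment> \<open>The gap \<open>M\<close> of the point system serves for measures as well,
    because each tuple of points is shadowed with the same \<open>a\<close>, \<open>b\<close> and
    \<open>p\<close>.\<close>
  proof (intro exI[of _ M] conjI allI impI)
    fix s p :: nat and \<mu> :: "nat \<Rightarrow> 'a measure" and a b :: "nat \<Rightarrow> nat"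
    assume hyps: "s \<ge> 1" "\<forall>i\<in>{1..s}. \<mu> i \<in> prob_measures X" "\<forall>i\<in>{1..s}. a i \<le> b i"
      "\<forall>j\<in>{2..s}. b (j - 1) < a j \<and> a j - b (j - 1) > M" "p > M + b s - a 1"
    have "\<exists>\<nu>\<in>prob_measures X. periodic_point (induced X f) p \<nu> \<and> (\<forall>i\<in>{1..s}. \<forall>j\<in>{a i..b i}.
        prohorov X (iter (induced X f) j \<nu>) (iter (induced X f) j (\<mu> i)) \<le> 2 * (\<epsilon> / 4))"
    proof (rule induced_specification_witness[OF assms(1) \<open>\<epsilon> / 4 > 0\<close>])
      show "\<exists>z\<in>X. periodic_point f p z \<and>
          (\<forall>i\<in>{1..s}. \<forall>j\<in>{a i..b i}. dist (iter f j z) (iter f j (x i)) < \<epsilon> / 4)"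
        if "\<And>i. i \<in> {1..s} \<Longrightarrow> x i \<in> X" for x
        using M hyps(1,3-5) that by blast
    qed (use hyps in auto)
    moreover have "2 * (\<epsilon> / 4) < \<epsilon>"
      using \<open>\<epsilon> > 0\<close> by simp
    ultimately show "\<exists>\<nu>\<in>prob_measures X. periodic_point (induced X f) p \<nu> \<and>
        (\<forall>i\<in>{1..s}. \<forall>j\<in>{a i..b i}.
          prohorov X (iter (induced X f) j \<nu>) (iter (induced X f) j (\<mu> i)) < \<epsilon>)"
      by (meson order.strict_trans1)
  qed (rule \<open>M \<ge> 1\<close>)
qed

end
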